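(* Under the standing assumptions A1--A4 (see context), let $(u_k)_{k\in\mathbb N}$ be generated by the proximal gradient algorithm (see context) with stepsize bounds $0<L_a\le L_b<\infty$. Assume that there is a subsequence $(u_{k_j})_j$ with $u_{k_j}\to\bar u$ strongly in $\mathcal U$ such that $\bar u$ satisfies the Polyak--Łojasiewicz--Kurdyka property with $X\in\{\mathcal U^*,Y\}$: there are constants $R,\lambda,\eta>0$ with $$J(u)-J(\bar u)\le\frac\lambda2\inf\{\|\nabla f(u)+\xi\|_X^2\mid\xi\in\partial g(u)\cap X\}\qquad\forall u\in\mathcal U\text{ with }\|u-\bar u\|_{\mathcal U}\le R,\ J(u)\le J(\bar u)+\eta.$$ In case $X=Y$, assume additionally that for every $k\in\mathbb N$ the subgradient $\xi_k\in\partial g(u_{k+1})$ with $-\nabla f(u_k)-\xi_k\in\frac{L_k}{2}\,\partial\big(\|\cdot-u_k\|_{\mathcal U}^2\big)(u_{k+1})$ can be chosen in $Y$. Then there is $C>0$ such that, with $$\sigma:=\frac{L_a}{\lambda(L_{\nabla f}+L_b)^2},\qquad\mu:=\sqrt{1/(1+\sigma)}<1,$$ we have $$J(u_{k+1})-J(\bar u)\le\frac1{1+\sigma}\big(J(u_k)-J(\bar u)\big)\qquad\text{and}\qquad\|u_k-\bar u\|_{\mathcal U}\le C\mu^k$$ for all $k\in\mathbb N$ large enough.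
   Context: Standing assumptions. (A1) $\mathcal U\cong Y^*$, where $Y$ is a separable Banach space with norm $\|\cdot\|_Y$; $\langle\cdot,\cdot\rangle$ is the pairing between $Y$ and $\mathcal U$, and $\mathcal U$ carries the dual norm $\|u\|_{\mathcal U}=\sup_{\|y\|_Y\le1}\langle y,u\rangle$. (A2) $g:\mathcal U\to[0,\infty]$ is proper, convex and sequentially weak* lower semicontinuous. (A3) $f:\mathcal U\to[0,\infty)$ is sequentially weak* lower semicontinuous on $\operatorname{dom}g$, and there are a neighborhood $\mathcal N$ of $\operatorname{dom}g$ in $\mathcal U$ and a map $\nabla f:\operatorname{dom}g\to Y$ such that $f$ is Gâteaux differentiable on $\mathcal N$ with $f'(u)(\delta u)=\langle\nabla f(u),\delta u\rangle$ for all $u\in\operatorname{dom}g$, $\delta u\in\mathcal U$; moreover there is $L_{\nabla f}\ge0$ with $\|\nabla f(u_1)-\nabla f(u_2)\|_Y\le L_{\nabla f}\|u_1-u_2\|_{\mathcal U}$ for all $u_1,u_2\in\operatorname{dom}g$. (A4) With $J:=f+g$: if $\|u_k\|_{\mathcal U}\to\infty$ then $J(u_k)\to\infty$. $\mathcal U^*$ is the dual of $\mathcal U$ with its canonical norm; $Y$ is regarded as a subspace of $\mathcal U^*=Y^{**}$ via the canonical isometric embedding. $\partial$ denotes the convex subdifferential, a subset of $\mathcal U^*$. The infimum over the empty set is $+\infty$. Algorithm. Fix $u_0\in\operatorname{dom}g$ and $0<L_a\le L_b<\infty$. Put $\mathcal Q_L(v,u):=f(u)+\langle\nabla f(u),v-u\rangle+g(v)+\frac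 L2\|v-u\|_{\mathcal U}^2$. For each $k\in\mathbb N=\{0,1,\dots\}$ choose $u_{k+1}\in\operatorname{arg\,min}_{v\in\mathcal U}\mathcal Q_{L_k}(v,u_k)$, where $L_k$ is such that $L_k\in[L_a,L_b]$ and $J(u_{k+1})\le\mathcal Q_{L_k}(u_{k+1},u_k)$. (First-order optimality always provides some $\xi_k\in\partial g(u_{k+1})\subset\mathcal U^*$ as in the claim.) *)

theory Defs
  imports "HOL-Analysis.Analysis"
begin

text \<open>
  The space \<open>U = Y\<^sup>*\<close> is \<open>'y dual\<close>, whose library norm (the operator norm) is the dual norm;
  the pairing \<open>\<langle>y, u\<rangle>\<close> is \<open>blinfun_apply u y\<close>, and \<open>U\<^sup>* = Y\<^sup>*\<^sup>*\<close> is \<open>'y dual dual\<close>.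
\<close>

type_synonym 'a dual = "'a \<Rightarrow>\<^sub>L real"

lift_definition canonical_embedding :: "'y::real_normed_vector \<Rightarrow> 'y dual dual"
  is "\<lambda>y u. blinfun_apply u y"
  by (rule blinfun.bounded_linear_left)

definition seq_weak_star_tendsto ::
    "(nat \<Rightarrow> 'y::real_normed_vector dual) \<Rightarrow> 'y dual \<Rightarrow> bool" where
  "seq_weak_star_tendsto us u \<longleftrightarrow>
     (\<forall>y. (\<lambda>k. blinfun_apply (us k) y) \<longlonglongrightarrow> blinfun_apply u y)"

definition seq_weak_star_lsc_on ::
    "'y::real_normed_vector dual set \<Rightarrow> ('y dual \<Rightarrow> ereal) \<Rightarrow> bool" where
  "seq_weak_star_lsc_on S h \<longleftrightarrow>
     (\<forall>us u. (\<forall>k. us k \<in> S) \<longrightarrow> u \<in> S \<longrightarrow> seq_weak_star_tendsto us u \<longrightarrow>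
        h u \<le> liminf (\<lambda>k. h (us k)))"

definition edom :: "('a \<Rightarrow> ereal) \<Rightarrow> 'a set" where
  "edom h = {u. h u < \<infinity>}"

definition proper_fun :: "('a \<Rightarrow> ereal) \<Rightarrow> bool" where
  "proper_fun h \<longleftrightarrow> (\<forall>u. h u \<noteq> -\<infinity>) \<and> edom h \<noteq> {}"

text \<open>Only for functions that avoid \<open>-\<infinity>\<close>; note that \<open>0 * \<infinity> = 0\<close> in \<^typ>\<open>ereal\<close>.\<close>

definition econvex :: "('a::real_vector \<Rightarrow> ereal) \<Rightarrow> bool" where
  "econvex h \<longleftrightarrow> (\<forall>u v t. 0 \<le> t \<longrightarrow> t \<le> 1 \<longrightarrow>
     h ((1 - t) *\<^sub>R u + t *\<^sub>R v) \<le> ereal (1 - t) * h u + ereal t * h v)"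

definition subdifferential ::
    "('a::real_normed_vector \<Rightarrow> ereal) \<Rightarrow> 'a \<Rightarrow> 'a dual set" where
  "subdifferential h u =
     {\<xi>. \<bar>h u\<bar> \<noteq> \<infinity> \<and> (\<forall>v. h u + ereal (blinfun_apply \<xi> (v - u)) \<le> h v)}"

definition has_gateaux_derivative ::
    "('a::real_normed_vector \<Rightarrow> real) \<Rightarrow> 'a dual \<Rightarrow> 'a \<Rightarrow> bool" where
  "has_gateaux_derivative f D u \<longleftrightarrow>
     (\<forall>d. ((\<lambda>t. (f (u + t *\<^sub>R d) - f u) / t) \<longlongrightarrow> blinfun_apply D d) (at (0::real)))"

definition objective :: "('a \<Rightarrow> real) \<Rightarrow> ('a \<Rightarrow> ereal) \<Rightarrow> 'a \<Rightarrow> ereal" where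
  "objective f g u = ereal (f u) + g u"

definition prox_model ::
    "('y::real_normed_vector dual \<Rightarrow> real) \<Rightarrow> ('y dual \<Rightarrow> 'y) \<Rightarrow> ('y dual \<Rightarrow> ereal) \<Rightarrow>
     real \<Rightarrow> 'y dual \<Rightarrow> 'y dual \<Rightarrow> ereal" where
  "prox_model f grad g L v u =
     ereal (f u + blinfun_apply (v - u) (grad u)) + g v + ereal (L / 2 * (norm (v - u))\<^sup>2)"

definition prox_grad_iterates ::
    "('y::real_normed_vector dual \<Rightarrow> real) \<Rightarrow> ('y dual \<Rightarrow> 'y) \<Rightarrow> ('y dual \<Rightarrow> ereal) \<Rightarrow>
     real \<Rightarrow> real \<Rightarrow> (nat \<Rightarrow> 'y dual) \<Rightarrow> (nat \<Rightarrow> real) \<Rightarrow> bool" where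
  "prox_grad_iterates f grad g La Lb u L \<longleftrightarrow>
     u 0 \<in> edom g \<and>
     (\<forall>k. L k \<in> {La..Lb} \<and>
          is_arg_min (\<lambda>v. prox_model f grad g (L k) v (u k)) (\<lambda>v. True) (u (Suc k)) \<and>
          objective f g (u (Suc k)) \<le> prox_model f grad g (L k) (u (Suc k)) (u k))"

text \<open>The choice \<open>X \<in> {U\<^sup>*, Y}\<close>: \<open>Bidual\<close> stands for \<open>U\<^sup>*\<close> and \<open>Predual\<close> for \<open>Y\<close>.\<close>

datatype residual_space = Bidual | Predual

text \<open>
  The infimum of \<open>\<parallel>\<nabla>f(u) + \<xi>\<parallel>\<^sub>X\<^sup>2\<close> over \<open>\<xi> \<in> \<partial>g(u) \<inter> X\<close>. For \<open>X = Y\<close>, the elements of \<open>\<partial>g(u) \<inter> Y\<close>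
  are represented by elements of \<open>Y\<close> and the norm is that of \<open>Y\<close>.
\<close>

fun inf_sq_residual ::
    "residual_space \<Rightarrow> ('y::real_normed_vector dual \<Rightarrow> 'y) \<Rightarrow> ('y dual \<Rightarrow> ereal) \<Rightarrow>
     'y dual \<Rightarrow> ereal" where
  "inf_sq_residual Bidual grad g u =
     (INF \<xi>\<in>subdifferential g u. ereal ((norm (canonical_embedding (grad u) + \<xi>))\<^sup>2))"
| "inf_sq_residual Predual grad g u =
     (INF y\<in>{y. canonical_embedding y \<in> subdifferential g u}. ereal ((norm (grad u + y))\<^sup>2))"

definition PLK_property ::
    "residual_space \<Rightarrow> ('y::real_normed_vector dual \<Rightarrow> real) \<Rightarrow> ('y dual \<Rightarrow> 'y) \<Rightarrow>
     ('y dual \<Rightarrow> ereal) \<Rightarrow> 'y dual \<Rightarrow> real \<Rightarrow> real \<Rightarrow> real \<Rightarrow> bool" where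
  "PLK_property X f grad g ubar R lam eta \<longleftrightarrow>
     (\<forall>u. norm (u - ubar) \<le> R \<longrightarrow> objective f g u \<le> objective f g ubar + ereal eta \<longrightarrow>
        objective f g u - objective f g ubar \<le> ereal (lam / 2) * inf_sq_residual X grad g u)"

end

theory Submission
  imports Defs
begin

text \<open>
  Let \<open>e\<^sub>k = J(u\<^sub>k) - J(ubar)\<close> be the gap and \<open>d\<^sub>k = \<parallel>u\<^sub>k\<^sub>+\<^sub>1 - u\<^sub>k\<parallel>\<close> the length of a step. Three estimates
  compare them. Minimality in the subproblem and the sufficient-decrease test give the descent
  \<open>La/2 * d\<^sub>k\<^sup>2 \<le> e\<^sub>k - e\<^sub>k\<^sub>+\<^sub>1\<close> (\<open>descent\<close>). First-order optimality gives some \<open>\<xi>\<^sub>k \<in> \<partial>g(u\<^sub>k\<^sub>+\<^sub>1)\<close>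
  with \<open>\<parallel>\<nabla>f(u\<^sub>k) + \<xi>\<^sub>k\<parallel> \<le> L\<^sub>k d\<^sub>k\<close>, hence a residual of at most \<open>(Lgrad + Lb) * d\<^sub>k\<close> at \<open>u\<^sub>k\<^sub>+\<^sub>1\<close>
  (\<open>inf_sq_residual_le\<close>). Near \<open>ubar\<close> the Polyak--Lojasiewicz--Kurdyka property turns this
  into \<open>e\<^sub>k\<^sub>+\<^sub>1 \<le> lam/2 * (Lgrad + Lb)\<^sup>2 * d\<^sub>k\<^sup>2\<close>. Together: \<open>\<sigma> * e\<^sub>k\<^sub>+\<^sub>1 \<le> e\<^sub>k - e\<^sub>k\<^sub>+\<^sub>1\<close>
  (\<open>PLK_contraction\<close>).

  This needs \<open>u\<^sub>k\<^sub>+\<^sub>1\<close> to lie in the ball around \<open>ubar\<close> and \<open>e\<^sub>k\<^sub>+\<^sub>1 \<le> eta\<close>. The latter holds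
  eventually, because \<open>e\<^sub>k \<rightarrow> 0\<close> (\<open>J_tendsto\<close>): the values decrease, lower semicontinuity bounds
  their limit from below, and using \<open>ubar\<close> as a competitor in the subproblems along the
  subsequence bounds it from above. For the former, the descent gives
  \<open>d\<^sub>k \<le> sqrt (2 e\<^sub>k / La)\<close>, so that, as long as the gaps contract by \<open>\<mu>\<^sup>2\<close>, all remaining steps
  together have length at most \<open>sqrt (2 e\<^sub>k / La) / (1 - \<mu>)\<close>. Once an element of the
  subsequence is close enough to \<open>ubar\<close> and its gap is small enough, the sequence can no longer
  leave the ball, and the same bound on the remaining path is the rate
  (\<open>trapped_sequence_converges_linearly\<close>).

  Two facts about duals enter: the sum rule for subdifferentials that yields \<open>\<xi>\<^sub>k \<in> U\<^sup>*\<close>, and the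
  isometry of the embedding \<open>Y \<rightarrow> Y\<^sup>*\<^sup>*\<close>, by which the residual can be measured in \<open>Y\<close>. Both are
  instances of one form of the Hahn--Banach theorem (\<open>convex_subgradient_above_cone\<close>).
\<close>

section \<open>Hahn--Banach: subgradients below a cone\<close>

definition sublinear :: "('a::real_vector \<Rightarrow> real) \<Rightarrow> bool" where
  "sublinear p \<longleftrightarrow> (\<forall>x y. p (x + y) \<le> p x + p y) \<and> (\<forall>x t. 0 \<le> t \<longrightarrow> p (t *\<^sub>R x) = t * p x)"

lemma sublinear_add: "sublinear p \<Longrightarrow> p (x + y) \<le> p x + p y"
  and sublinear_scale: "sublinear p \<Longrightarrow> 0 \<le> t \<Longrightarrow> p (t *\<^sub>R x) = t * p x"
  by (auto simp: sublinear_def)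

lemma sublinearI:
  assumes add: "\<And>x y. p (x + y) \<le> p x + p y"
    and zero: "p 0 = 0"
    and scale: "\<And>x t. 0 < t \<Longrightarrow> p (t *\<^sub>R x) \<le> t * p x"
  shows "sublinear p"
proof -
  have "p (t *\<^sub>R x) = t * p x" if t: "0 \<le> t" for x t
  proof (cases "t = 0")
    case True
    then show ?thesis by (simp add: zero)
  next
    case False
    with t have t: "0 < t" by simp
    have "p ((1 / t) *\<^sub>R (t *\<^sub>R x)) \<le> (1 / t) * p (t *\<^sub>R x)"
      using t by (intro scale) simp
    then have "t * p x \<le> p (t *\<^sub>R x)"
      using t by (simp add: field_simps)
    with scale[OF t, of x] show ?thesis by simp
  qed
  with add show ?thesis by (simp add: sublinear_def)
qed

lemma sublinear_zero: "sublinear p \<Longrightarrow> p 0 = 0"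
  using sublinear_scale[of p 0 0] by simp

lemma sublinear_ge_neg: "sublinear p \<Longrightarrow> - p (- x) \<le> p x"
  using sublinear_add[of p x "- x"] sublinear_zero[of p] by simp

lemma convex_on_combination:
  assumes "convex_on D \<phi>" "x \<in> D" "y \<in> D" "0 \<le> s" "0 \<le> t" "s + t = 1"
  shows "s *\<^sub>R x + t *\<^sub>R y \<in> D" "\<phi> (s *\<^sub>R x + t *\<^sub>R y) \<le> s * \<phi> x + t * \<phi> y"
  using assms unfolding convex_on_def convex_def by blast+

text \<open>
  The largest sublinear function below both \<open>p\<close> and \<open>\<phi>\<close> (on \<open>D\<close>) is
  \<open>x \<mapsto> inf {p (x - t w) + t \<phi>(w) | t \<ge> 0, w \<in> D}\<close>: the epigraph of \<open>p\<close> is enlarged by the convex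
  cone that the epigraph of \<open>\<phi>\<close> generates. The lower bound on \<open>\<phi>\<close> keeps the infimum finite. The lemma serves twice: with a single point as \<open>D\<close> it shows that
  minimal sublinear functions are linear, and with the domain of a convex function as \<open>D\<close> it
  produces subgradients.
\<close>

lemma sublinear_minorant:
  fixes p \<phi> :: "'a::real_vector \<Rightarrow> real"
  assumes p: "sublinear p" and \<phi>: "convex_on D \<phi>" and D: "D \<noteq> {}"
    and below: "\<And>w. w \<in> D \<Longrightarrow> - p (- w) \<le> \<phi> w"
  obtains m where "sublinear m" "\<And>x. m x \<le> p x" "\<And>w. w \<in> D \<Longrightarrow> m w \<le> \<phi> w"
proof
  define h where "h x z = p (x - fst z *\<^sub>R snd z) + fst z * \<phi> (snd z)" for x and z :: "real \<times> 'a"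
  let ?Z = "{0::real..} \<times> D"
  let ?m = "\<lambda>x. INF z\<in>?Z. h x z"
  obtain w0 where w0: "w0 \<in> D" using D by auto
  then have "(0, w0) \<in> ?Z" by simp
  then have ne: "?Z \<noteq> {}" by blast
  have lb: "- p (- x) \<le> h x z" if z: "z \<in> ?Z" for x z
  proof -
    obtain t w where z': "z = (t, w)" "0 \<le> t" "w \<in> D" using z by auto
    have "p (t *\<^sub>R (- w)) \<le> p (x - t *\<^sub>R w) + p (- x)"
      using sublinear_add[OF p, of "x - t *\<^sub>R w" "- x"] by simp
    moreover have "t * (- p (- w)) \<le> t * \<phi> w"
      using z' below by (intro mult_left_mono) auto
    ultimately show ?thesis
      using sublinear_scale[OF p \<open>0 \<le> t\<close>, of "- w"] by (simp add: h_def z')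
  qed
  have bdd: "bdd_below (h x ` ?Z)" for x
    using lb by (intro bdd_belowI2[where m = "- p (- x)"])
  have le: "?m x \<le> h x (t, w)" if "0 \<le> t" "w \<in> D" for x t w
    using that by (intro cINF_lower[OF bdd]) auto
  have comb: "?m (x + y) \<le> h x z1 + h y z2" if z: "z1 \<in> ?Z" "z2 \<in> ?Z" for x y z1 z2
  proof -
    obtain t1 w1 t2 w2 where z': "z1 = (t1, w1)" "0 \<le> t1" "w1 \<in> D"
      "z2 = (t2, w2)" "0 \<le> t2" "w2 \<in> D" using z by auto
    define t where "t = t1 + t2"
    show ?thesis
    proof (cases "t = 0")
      case True
      then have "t1 = 0" "t2 = 0" using z' by (auto simp: t_def)
      then show ?thesis
        using le[of 0 w1 "x + y"] z' sublinear_add[OF p, of x y] by (simp add: h_def)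
    next
      case False
      then have t: "0 < t" using z' by (auto simp: t_def)
      define w where "w = (t1 / t) *\<^sub>R w1 + (t2 / t) *\<^sub>R w2"
      have sum1: "t1 / t + t2 / t = 1" using t by (simp add: t_def add_divide_distrib[symmetric])
      have w: "w \<in> D" "\<phi> w \<le> (t1 / t) * \<phi> w1 + (t2 / t) * \<phi> w2"
        unfolding w_def using \<phi> z' t sum1 by (intro convex_on_combination; simp)+
      from w(2) have "t * \<phi> w \<le> t * ((t1 / t) * \<phi> w1 + (t2 / t) * \<phi> w2)"
        using t by (intro mult_left_mono) auto
      then have A: "t * \<phi> w \<le> t1 * \<phi> w1 + t2 * \<phi> w2"
        using t by (simp add: distrib_left)
      have "t *\<^sub>R w = t1 *\<^sub>R w1 + t2 *\<^sub>R w2"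
        using t by (simp add: w_def scaleR_add_right)
      then have "x + y - t *\<^sub>R w = (x - t1 *\<^sub>R w1) + (y - t2 *\<^sub>R w2)"
        by (simp add: algebra_simps)
      then have "p (x + y - t *\<^sub>R w) \<le> p (x - t1 *\<^sub>R w1) + p (y - t2 *\<^sub>R w2)"
        using sublinear_add[OF p] by metis
      with A le[of t w "x + y"] t w(1) show ?thesis by (simp add: h_def z')
    qed
  qed
  show "sublinear ?m"
  proof (rule sublinearI)
    fix x y
    have "?m (x + y) - h y z2 \<le> ?m x" if "z2 \<in> ?Z" for z2
      using comb[OF _ that] by (intro cINF_greatest ne) (simp only: diff_le_eq)
    then have "?m (x + y) - ?m x \<le> h y z2" if "z2 \<in> ?Z" for z2
      using that by (metis diff_le_eq add.commute)
    then have "?m (x + y) - ?m x \<le> ?m y" by (intro cINF_greatest ne)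
    then show "?m (x + y) \<le> ?m x + ?m y" by simp
  next
    have "?m 0 \<le> 0" using le[of 0 w0 0] w0 sublinear_zero[OF p] by (simp add: h_def)
    moreover have "0 \<le> ?m 0"
      using lb[of _ 0] sublinear_zero[OF p] by (intro cINF_greatest ne) simp
    ultimately show "?m 0 = 0" by simp
  next
    fix x :: 'a and t :: real assume t: "0 < t"
    have "?m (t *\<^sub>R x) / t \<le> h x z" if z: "z \<in> ?Z" for z
    proof -
      obtain s w where z': "z = (s, w)" "0 \<le> s" "w \<in> D" using z by auto
      have "t *\<^sub>R x - (t * s) *\<^sub>R w = t *\<^sub>R (x - s *\<^sub>R w)" by (simp add: algebra_simps)
      then have "h (t *\<^sub>R x) (t * s, w) = t * h x z"
        using sublinear_scale[OF p, of t "x - s *\<^sub>R w"] t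
        by (simp add: h_def z' distrib_left mult.assoc)
      then show ?thesis
        using le[of "t * s" w "t *\<^sub>R x"] t z' by (simp add: field_simps)
    qed
    then have "?m (t *\<^sub>R x) / t \<le> ?m x" by (intro cINF_greatest ne)
    then show "?m (t *\<^sub>R x) \<le> t * ?m x" using t by (simp add: field_simps)
  qed
  show "?m x \<le> p x" for x
    using le[of 0 w0 x] w0 by (simp add: h_def)
  show "?m w \<le> \<phi> w" if "w \<in> D" for w
    using le[of 1 w w] that sublinear_zero[OF p] by (simp add: h_def)
qed

text \<open>
  The pointwise infimum of a chain of sublinear functions below \<open>p\<close> is again sublinear, so Zorn's
  lemma applies to the reversed pointwise order.
\<close>

lemma exists_minimal_sublinear:
  fixes p :: "'a::real_vector \<Rightarrow> real"
  assumes p: "sublinear p"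
  obtains q where "sublinear q" "q \<le> p" "\<And>m. sublinear m \<Longrightarrow> m \<le> q \<Longrightarrow> m = q"
proof -
  let ?A = "{q. sublinear q \<and> q \<le> p}"
  have po: "partial_order_on ?A (relation_of (\<ge>) ?A)"
    by (rule partial_order_on_relation_ofI) auto
  have ch: "\<exists>i\<in>?A. \<forall>q\<in>C. i \<le> q" if C: "C \<in> Chains (relation_of (\<ge>) ?A)" for C
  proof (cases "C = {}")
    case True
    then show ?thesis using p by auto
  next
    case False
    have CA: "C \<subseteq> ?A" using Chains_relation_of[OF C] .
    have total: "a \<le> b \<or> b \<le> a" if "a \<in> C" "b \<in> C" for a b
      using C that by (auto simp: Chains_def relation_of_def)
    let ?i = "\<lambda>x. INF q\<in>C. q x"
    have lb: "- p (- x) \<le> q x" if "q \<in> C" for q x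
    proof -
      have "sublinear q" "q (- x) \<le> p (- x)" using CA that by (auto simp: le_fun_def)
      then show ?thesis using sublinear_ge_neg[of q x] by linarith
    qed
    have bdd: "bdd_below ((\<lambda>q. q x) ` C)" for x
      using lb by (intro bdd_belowI2[where m = "- p (- x)"])
    have le: "?i x \<le> q x" if "q \<in> C" for q x
      using that by (intro cINF_lower[OF bdd])
    have "sublinear ?i"
    proof (rule sublinearI)
      fix x y
      have "?i (x + y) \<le> a x + b y" if ab: "a \<in> C" "b \<in> C" for a b
      proof -
        obtain c where c: "c \<in> C" "c \<le> a" "c \<le> b" using total[OF ab] ab by blast
        have "?i (x + y) \<le> c (x + y)" by (rule le[OF c(1)])
        also have "\<dots> \<le> c x + c y" using CA c by (intro sublinear_add) auto
        also have "\<dots> \<le> a x + b y" using c by (intro add_mono) (auto simp: le_fun_def)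
        finally show ?thesis .
      qed
      then have "?i (x + y) - b y \<le> ?i x" if "b \<in> C" for b
        using that by (intro cINF_greatest False) (simp only: diff_le_eq)
      then have "?i (x + y) - ?i x \<le> b y" if "b \<in> C" for b
        using that by (metis diff_le_eq add.commute)
      then have "?i (x + y) - ?i x \<le> ?i y" by (intro cINF_greatest False)
      then show "?i (x + y) \<le> ?i x + ?i y" by simp
    next
      have "q 0 = 0" if "q \<in> C" for q using CA that by (intro sublinear_zero) auto
      then have "(\<lambda>q. q 0) ` C = (\<lambda>q. 0) ` C" by (intro image_cong) auto
      then show "?i 0 = 0" using False by simp
    next
      fix x :: 'a and t :: real assume t: "0 < t"
      have "?i (t *\<^sub>R x) / t \<le> q x" if "q \<in> C" for q
      proof -
        have "q (t *\<^sub>R x) = t * q x" using CA that t by (intro sublinear_scale) auto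
        then show ?thesis using le[OF that, of "t *\<^sub>R x"] t by (simp add: field_simps)
      qed
      then have "?i (t *\<^sub>R x) / t \<le> ?i x" by (intro cINF_greatest False)
      then show "?i (t *\<^sub>R x) \<le> t * ?i x" using t by (simp add: field_simps)
    qed
    moreover have "?i \<le> p"
    proof -
      obtain q where q: "q \<in> C" using False by auto
      then have "q \<le> p" using CA by auto
      then show ?thesis using le[OF q] by (intro le_funI) (blast intro: order_trans dest: le_funD)
    qed
    ultimately show ?thesis using le by (intro bexI[where x = ?i]) (auto simp: le_fun_def)
  qed
  obtain q where q: "q \<in> ?A" "\<forall>a\<in>?A. a \<le> q \<longrightarrow> a = q"
    using predicate_Zorn[OF po ch] by auto
  have "m = q" if "sublinear m" "m \<le> q" for m
    using q that by (auto intro: order_trans)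
  with q that show ?thesis by auto
qed

text \<open>
  A minimal sublinear function \<open>q\<close> is linear: lowering it at \<open>- y\<close> towards \<open>- q y\<close> gives a
  sublinear function below \<open>q\<close>, which must be \<open>q\<close> itself, and so \<open>q (- y) = - q y\<close>.
\<close>

lemma exists_linear_below_sublinear:
  fixes p :: "'a::real_vector \<Rightarrow> real"
  assumes p: "sublinear p"
  obtains l where "linear l" "\<And>x. l x \<le> p x"
proof -
  obtain q where q: "sublinear q" "q \<le> p" and min: "\<And>m. sublinear m \<Longrightarrow> m \<le> q \<Longrightarrow> m = q"
    using exists_minimal_sublinear[OF p] by blast
  have odd: "q (- y) = - q y" for y
  proof -
    obtain m where m: "sublinear m" "\<And>x. m x \<le> q x" "\<And>w. w \<in> {- y} \<Longrightarrow> m w \<le> - q y"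
      by (rule sublinear_minorant[OF q(1), of "{- y}" "\<lambda>_. - q y"])
        (auto simp: convex_on_def algebra_simps simp flip: distrib_left distrib_right)
    have "m = q" using m by (intro min) (auto simp: le_fun_def)
    then show ?thesis using m(3)[of "- y"] sublinear_ge_neg[OF q(1), of "- y"] by simp
  qed
  have "linear q"
  proof (rule linearI)
    fix x y
    have "q (- x + - y) \<le> q (- x) + q (- y)" by (rule sublinear_add[OF q(1)])
    then have "- q (x + y) \<le> - q x + - q y" using odd[of "x + y"] odd[of x] odd[of y] by simp
    then show "q (x + y) = q x + q y" using sublinear_add[OF q(1), of x y] by simp
  next
    fix t :: real and x
    show "q (t *\<^sub>R x) = t *\<^sub>R q x"
    proof (cases "0 \<le> t")
      case True
      then show ?thesis using sublinear_scale[OF q(1)] by simp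
    next
      case False
      then have "q ((- t) *\<^sub>R x) = - t * q x" using sublinear_scale[OF q(1), of "- t"] by simp
      then show ?thesis using odd[of "t *\<^sub>R x"] by simp
    qed
  qed
  with q that show ?thesis by (auto simp: le_fun_def)
qed

text \<open>
  If a convex function lies above a downward cone of slope \<open>c\<close> with vertex on its graph, then it
  has a subgradient of norm at most \<open>c\<close> at the vertex: this is the sum rule
  \<open>0 \<in> \<partial>H(b) + c\<partial>\<parallel>\<cdot> - b\<parallel>(b)\<close>.
\<close>

lemma convex_subgradient_above_cone:
  fixes H :: "'a::real_normed_vector \<Rightarrow> real"
  assumes H: "convex_on D H" and b: "b \<in> D" and c: "0 \<le> c"
    and cone: "\<And>v. v \<in> D \<Longrightarrow> H b - c * norm (v - b) \<le> H v"
  obtains l :: "'a dual" where "norm l \<le> c" "\<And>v. v \<in> D \<Longrightarrow> H b + l (v - b) \<le> H v"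
proof -
  let ?D = "{w. b + w \<in> D}" and ?\<phi> = "\<lambda>w. H (b + w) - H b"
  have shift: "b + (s *\<^sub>R x + t *\<^sub>R y) = s *\<^sub>R (b + x) + t *\<^sub>R (b + y)" if "s + t = 1"
    for s t :: real and x y
  proof -
    have "s *\<^sub>R b + t *\<^sub>R b = b" using that by (metis scaleR_add_left scaleR_one)
    then have "b + (s *\<^sub>R x + t *\<^sub>R y) = (s *\<^sub>R b + t *\<^sub>R b) + (s *\<^sub>R x + t *\<^sub>R y)" by simp
    then show ?thesis by (simp add: scaleR_add_right)
  qed
  have "convex_on ?D ?\<phi>"
    unfolding convex_on_def convex_def
  proof (intro conjI ballI allI impI CollectI)
    fix x y and s t :: real
    assume xy: "x \<in> ?D" "y \<in> ?D" and st: "0 \<le> s" "0 \<le> t" "s + t = 1"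
    show "b + (s *\<^sub>R x + t *\<^sub>R y) \<in> D"
      unfolding shift[OF st(3)] using H xy st by (intro convex_on_combination) auto
    have "H (s *\<^sub>R (b + x) + t *\<^sub>R (b + y)) \<le> s * H (b + x) + t * H (b + y)"
      using H xy st by (intro convex_on_combination) auto
    moreover have "H b = s * H b + t * H b"
      using st by (simp flip: distrib_right)
    ultimately show "H (b + (s *\<^sub>R x + t *\<^sub>R y)) - H b
        \<le> s * (H (b + x) - H b) + t * (H (b + y) - H b)"
      using shift[OF st(3), of x y] by (simp add: right_diff_distrib)
  qed
  moreover have "sublinear (\<lambda>x::'a. c * norm x)"
  proof (rule sublinearI)
    show "c * norm (x + y) \<le> c * norm x + c * norm y" for x y :: 'a
      using c norm_triangle_ineq[of x y] by (metis distrib_left mult_left_mono)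
  qed auto
  moreover have "- (c * norm (- w)) \<le> ?\<phi> w" if "w \<in> ?D" for w
    using cone[of "b + w"] that by simp
  moreover have "0 \<in> ?D" using b by simp
  ultimately obtain m where m: "sublinear m" "\<And>x. m x \<le> c * norm x"
      "\<And>w. w \<in> ?D \<Longrightarrow> m w \<le> ?\<phi> w"
    using sublinear_minorant[of "\<lambda>x. c * norm x" ?D ?\<phi>] by blast
  obtain k where k: "linear k" "\<And>x. k x \<le> m x"
    using exists_linear_below_sublinear[OF m(1)] by blast
  have kb: "\<bar>k x\<bar> \<le> c * norm x" for x
    using order_trans[OF k(2) m(2), of x] order_trans[OF k(2) m(2), of "- x"]
      linear_neg[OF k(1), of x] by simp
  have "bounded_linear k"
    using k(1) kb by (auto simp: bounded_linear_def bounded_linear_axioms_def mult.commute)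
  then have app: "blinfun_apply (Blinfun k) = k" by (rule bounded_linear_Blinfun_apply)
  show ?thesis
  proof
    show "norm (Blinfun k) \<le> c" using c kb by (intro norm_blinfun_bound) (auto simp: app)
    show "H b + Blinfun k (v - b) \<le> H v" if "v \<in> D" for v
      using order_trans[OF k(2) m(3), of "v - b"] that by (simp add: app)
  qed
qed

lemma canonical_embedding_apply [simp]: "blinfun_apply (canonical_embedding y) v = blinfun_apply v y"
  by transfer simp

lemma canonical_embedding_add: "canonical_embedding (x + y) = canonical_embedding x + canonical_embedding y"
  and canonical_embedding_diff: "canonical_embedding (x - y) = canonical_embedding x - canonical_embedding y"
  by (auto intro!: blinfun_eqI simp: blinfun.bilinear_simps)

text \<open>A subgradient of the norm at \<open>y\<close> is a functional of norm at most 1 that attains \<open>\<parallel>y\<parallel>\<close> at \<open>y\<close>.\<close>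

lemma norm_canonical_embedding: "norm (canonical_embedding y) = norm y"
proof (rule antisym)
  show "norm (canonical_embedding y) \<le> norm y"
  proof (rule norm_blinfun_bound)
    show "norm (canonical_embedding y v) \<le> norm y * norm v" for v
      using norm_blinfun[of v y] by (simp add: mult.commute)
  qed simp
  have "norm y - 1 * norm (v - y) \<le> norm v" for v
    using norm_triangle_ineq2[of y v] by (simp add: norm_minus_commute)
  moreover have "convex_on UNIV (\<lambda>v::'a. norm v)"
    using convex_on_dist[of UNIV 0] by simp
  ultimately obtain l :: "'a dual" where l: "norm l \<le> 1" "\<And>v. norm y + l (v - y) \<le> norm v"
    using convex_subgradient_above_cone[of UNIV norm y 1] by auto
  have "norm y \<le> l y" using l(2)[of 0] by (simp add: blinfun.minus_right)
  also have "\<dots> = canonical_embedding y l" by simp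
  also have "\<dots> \<le> norm (canonical_embedding y) * norm l"
    using norm_blinfun[of "canonical_embedding y" l] by (simp add: abs_le_iff)
  also have "\<dots> \<le> norm (canonical_embedding y)"
    using l(1) by (simp add: mult_left_le)
  finally show "norm y \<le> norm (canonical_embedding y)" .
qed

section \<open>One proximal step\<close>

lemma le_if_le_up_to_second_order:
  fixes A B E :: real
  assumes "\<And>t. 0 < t \<Longrightarrow> t \<le> 1 \<Longrightarrow> t * A \<le> t * B + t\<^sup>2 * E"
  shows "A \<le> B"
proof (rule tendsto_le[where F = "at_right 0"])
  show "((\<lambda>t. B + t * E) \<longlongrightarrow> B) (at_right 0)"
    by (auto intro!: tendsto_eq_intros)
  show "\<forall>\<^sub>F t in at_right 0. A \<le> B + t * E"
    using eventually_at_right_less[of 0] eventually_at_right_real[of 0 1, simplified]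
  proof eventually_elim
    case (elim t)
    then have "t * A \<le> t * (B + t * E)"
      using assms[of t] by (simp add: power2_eq_square algebra_simps)
    then show ?case using elim by simp
  qed
qed auto

text \<open>
  The number \<open>\<delta>\<close> bounds the rate at which the distance to \<open>a\<close> grows on the way from \<open>b\<close> to \<open>w\<close>.
  For a general \<open>w\<close> it is \<open>\<parallel>w - b\<parallel>\<close>; towards the centre \<open>a\<close> itself it is \<open>- \<parallel>b - a\<parallel>\<close>. The
  convex part \<open>H\<close> must outweigh the first-order change of the quadratic term.
\<close>

lemma prox_minimizer_first_order:
  fixes H :: "'a::real_normed_vector \<Rightarrow> real"
  assumes H: "convex_on D H" and b: "b \<in> D" and w: "w \<in> D" and L: "0 \<le> L"
    and min: "\<And>v. v \<in> D \<Longrightarrow> H b + L / 2 * (norm (b - a))\<^sup>2 \<le> H v + L / 2 * (norm (v - a))\<^sup>2"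
    and \<delta>: "\<And>t. 0 < t \<Longrightarrow> t \<le> 1 \<Longrightarrow> norm (b + t *\<^sub>R (w - b) - a) \<le> norm (b - a) + t * \<delta>"
  shows "H b \<le> H w + L * norm (b - a) * \<delta>"
proof -
  have "t * (H b - H w) \<le> t * (L * norm (b - a) * \<delta>) + t\<^sup>2 * (L / 2 * \<delta>\<^sup>2)"
    if t: "0 < t" "t \<le> 1" for t
  proof -
    let ?v = "b + t *\<^sub>R (w - b)"
    have v: "?v = (1 - t) *\<^sub>R b + t *\<^sub>R w" by (simp add: algebra_simps)
    have D: "?v \<in> D" and "H ?v \<le> (1 - t) * H b + t * H w"
      unfolding v using H b w t by (intro convex_on_combination; simp)+
    moreover have "L / 2 * (norm (?v - a))\<^sup>2 \<le> L / 2 * (norm (b - a) + t * \<delta>)\<^sup>2"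
      using L \<delta>[OF t] by (intro mult_left_mono power_mono) auto
    moreover note min[OF D]
    ultimately show ?thesis by (simp add: power2_eq_square algebra_simps)
  qed
  from le_if_le_up_to_second_order[OF this] show ?thesis by simp
qed

lemma prox_minimizer_above_cone:
  fixes H :: "'a::real_normed_vector \<Rightarrow> real"
  assumes "convex_on D H" "b \<in> D" "w \<in> D" "0 \<le> L"
    and "\<And>v. v \<in> D \<Longrightarrow> H b + L / 2 * (norm (b - a))\<^sup>2 \<le> H v + L / 2 * (norm (v - a))\<^sup>2"
  shows "H b - L * norm (b - a) * norm (w - b) \<le> H w"
proof -
  have "norm (b + t *\<^sub>R (w - b) - a) \<le> norm (b - a) + t * norm (w - b)" if "0 < t" for t
    using norm_triangle_ineq[of "b - a" "t *\<^sub>R (w - b)"] that by (simp add: diff_add_eq)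
  then show ?thesis using prox_minimizer_first_order[OF assms(1-5), of "norm (w - b)"] by simp
qed

lemma prox_minimizer_decrease:
  fixes H :: "'a::real_normed_vector \<Rightarrow> real"
  assumes "convex_on D H" "b \<in> D" "a \<in> D" "0 \<le> L"
    and "\<And>v. v \<in> D \<Longrightarrow> H b + L / 2 * (norm (b - a))\<^sup>2 \<le> H v + L / 2 * (norm (v - a))\<^sup>2"
  shows "H b + L * (norm (b - a))\<^sup>2 \<le> H a"
proof -
  have "norm (b + t *\<^sub>R (a - b) - a) \<le> norm (b - a) + t * (- norm (b - a))"
    if "0 < t" "t \<le> 1" for t
  proof -
    have "b + t *\<^sub>R (a - b) - a = (1 - t) *\<^sub>R (b - a)" by (simp add: algebra_simps)
    then have "norm (b + t *\<^sub>R (a - b) - a) = (1 - t) * norm (b - a)" using that by simp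
    then show ?thesis by (simp add: left_diff_distrib)
  qed
  then show ?thesis
    using prox_minimizer_first_order[OF assms(1-5), of "- norm (b - a)"]
    by (simp add: power2_eq_square)
qed

lemma norm_subgradient_sq_dist_le:
  fixes \<zeta> :: "'a::real_normed_vector dual"
  assumes "\<zeta> \<in> subdifferential (\<lambda>v. ereal ((norm (v - a))\<^sup>2)) b"
  shows "norm \<zeta> \<le> 2 * norm (b - a)"
proof (rule norm_blinfun_bound)
  have bound: "\<zeta> d \<le> 2 * norm (b - a) * norm d" for d
  proof (rule le_if_le_up_to_second_order)
    fix t :: real assume t: "0 < t"
    have "(norm (b - a))\<^sup>2 + \<zeta> ((b + t *\<^sub>R d) - b) \<le> (norm (b + t *\<^sub>R d - a))\<^sup>2"
      using assms unfolding subdifferential_def by (auto dest: spec[of _ "b + t *\<^sub>R d"])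
    also have "\<dots> \<le> (norm (b - a) + t * norm d)\<^sup>2"
      using norm_triangle_ineq[of "b - a" "t *\<^sub>R d"] t
      by (intro power_mono) (auto simp: algebra_simps)
    finally show "t * \<zeta> d \<le> t * (2 * norm (b - a) * norm d) + t\<^sup>2 * (norm d)\<^sup>2"
      by (simp add: blinfun.scaleR_right power2_eq_square algebra_simps)
  qed
  show "norm (\<zeta> d) \<le> 2 * norm (b - a) * norm d" for d
    using bound[of d] bound[of "- d"] by (simp add: blinfun.minus_right)
qed simp

section \<open>Sequences trapped near an accumulation point\<close>

text \<open>
  While \<open>\<psi>\<close> contracts, it pays for the steps: \<open>(1 - \<mu>) * \<psi> k \<le> \<psi> k - \<psi> (k + 1)\<close>, so that
  \<open>dist (x k) p + \<psi> k\<close> does not increase, for every point \<open>p\<close>. With \<open>p = z\<close> this keeps the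
  sequence in the ball where the contraction is available, once it has come close enough to \<open>z\<close>;
  with \<open>p = x k\<close> it bounds the remaining path by \<open>\<psi> k\<close>.
\<close>

lemma trapped_sequence_converges_linearly:
  fixes x :: "nat \<Rightarrow> 'a::metric_space" and \<psi> :: "nat \<Rightarrow> real"
  assumes \<mu>: "0 < \<mu>" "\<mu> < 1" and R: "0 < R"
    and \<psi>_nonneg: "\<And>k. 0 \<le> \<psi> k" and \<psi>_lim: "\<psi> \<longlonglongrightarrow> 0"
    and step: "\<And>k. dist (x (Suc k)) (x k) \<le> (1 - \<mu>) * \<psi> k"
    and contraction: "\<forall>\<^sub>F k in sequentially. dist (x (Suc k)) z \<le> R \<longrightarrow> \<psi> (Suc k) \<le> \<mu> * \<psi> k"
    and r: "strict_mono r" and sub: "(\<lambda>j. x (r j)) \<longlonglongrightarrow> z"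
  shows "\<exists>C>0. \<forall>\<^sub>F k in sequentially. dist (x k) z \<le> R \<and> dist (x k) z \<le> C * \<mu> ^ k"
proof -
  obtain K where K: "\<And>k. k \<ge> K \<Longrightarrow> dist (x (Suc k)) z \<le> R \<Longrightarrow> \<psi> (Suc k) \<le> \<mu> * \<psi> k"
    using contraction by (auto simp: eventually_sequentially)
  have r_top: "filterlim r at_top sequentially" using r by (rule filterlim_subseq)
  have "(\<lambda>j. dist (x (r j)) z + \<psi> (r j)) \<longlonglongrightarrow> 0 + 0"
    using sub filterlim_compose[OF \<psi>_lim r_top]
    by (intro tendsto_add) (simp_all only: tendsto_dist_iff[of _ z])
  then have "\<forall>\<^sub>F j in sequentially. dist (x (r j)) z + \<psi> (r j) < R"
    using R by (auto intro: order_tendstoD)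
  moreover have "\<forall>\<^sub>F j in sequentially. K \<le> r j"
    using r_top by (auto simp: filterlim_at_top)
  ultimately have "\<forall>\<^sub>F j in sequentially. dist (x (r j)) z + \<psi> (r j) < R \<and> K \<le> r j"
    by eventually_elim simp
  then obtain j where j: "dist (x (r j)) z + \<psi> (r j) < R" "K \<le> r j"
    by (auto dest: eventually_happens)
  define m where "m = r j"
  have in_ball: "dist (x (Suc k)) z \<le> R" if "dist (x k) z + \<psi> k \<le> R" for k
  proof -
    have "dist (x (Suc k)) z \<le> dist (x (Suc k)) (x k) + dist (x k) z" by (rule dist_triangle)
    moreover have "(1 - \<mu>) * \<psi> k \<le> \<psi> k" using \<mu> \<psi>_nonneg[of k] by (simp add: mult_left_le_one_le)
    ultimately show ?thesis using step[of k] that by linarith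
  qed
  have decrease: "dist (x (Suc k)) p + \<psi> (Suc k) \<le> dist (x k) p + \<psi> k"
    if "\<psi> (Suc k) \<le> \<mu> * \<psi> k" for k p
    using that step[of k] dist_triangle[of "x (Suc k)" p "x k"] by (simp add: algebra_simps)
  have trapped: "dist (x k) z + \<psi> k \<le> R" if "m \<le> k" for k
    using that
  proof (induction rule: dec_induct)
    case base
    then show ?case using j by (simp add: m_def)
  next
    case (step k)
    have "\<psi> (Suc k) \<le> \<mu> * \<psi> k"
      using step j in_ball by (intro K) (auto simp: m_def)
    then show ?case using decrease[of k z] step by simp
  qed
  have contr: "\<psi> (Suc k) \<le> \<mu> * \<psi> k" if "m \<le> k" for k
    using that j in_ball trapped by (intro K) (auto simp: m_def)
  have path: "dist (x n) p + \<psi> n \<le> dist (x k) p + \<psi> k" if "m \<le> k" "k \<le> n" for k n p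
    using that(2)
  proof (induction rule: dec_induct)
    case (step n)
    then show ?case using decrease[OF contr, of n p] that(1) by simp
  qed simp
  have tail: "dist (x k) z \<le> \<psi> k" if "m \<le> k" for k
  proof (rule tendsto_upperbound)
    show "(\<lambda>j. dist (x (r j)) (x k)) \<longlonglongrightarrow> dist (x k) z"
      using tendsto_dist[OF sub tendsto_const, of "x k"] by (simp add: dist_commute)
    have "\<forall>\<^sub>F j in sequentially. k \<le> r j" using r_top by (auto simp: filterlim_at_top)
    then show "\<forall>\<^sub>F j in sequentially. dist (x (r j)) (x k) \<le> \<psi> k"
    proof eventually_elim
      case (elim j)
      then show ?case using path[of k "r j" "x k"] that \<psi>_nonneg[of "r j"] by simp
    qed
  qed simp
  have geometric: "\<psi> k \<le> \<psi> m / \<mu> ^ m * \<mu> ^ k" if "m \<le> k" for k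
    using that
  proof (induction rule: dec_induct)
    case base
    then show ?case using \<mu> by simp
  next
    case (step k)
    have "\<psi> (Suc k) \<le> \<mu> * \<psi> k" using contr step by simp
    also have "\<dots> \<le> \<mu> * (\<psi> m / \<mu> ^ m * \<mu> ^ k)" using step \<mu> by (intro mult_left_mono) auto
    finally show ?case by (simp add: mult_ac)
  qed
  let ?C = "\<psi> m / \<mu> ^ m + 1"
  have "dist (x k) z \<le> R \<and> dist (x k) z \<le> ?C * \<mu> ^ k" if "m \<le> k" for k
  proof -
    have "\<psi> m / \<mu> ^ m * \<mu> ^ k \<le> ?C * \<mu> ^ k" using \<mu> by (intro mult_right_mono) auto
    with tail[OF that] geometric[OF that] trapped[OF that] \<psi>_nonneg[of k] show ?thesis by linarith
  qed
  then have "\<forall>\<^sub>F k in sequentially. dist (x k) z \<le> R \<and> dist (x k) z \<le> ?C * \<mu> ^ k"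
    by (auto simp: eventually_sequentially)
  moreover have "0 < ?C" using \<psi>_nonneg[of m] \<mu> by (simp add: add_nonneg_pos)
  ultimately show ?thesis by blast
qed

section \<open>Descent and contraction along the iteration\<close>

lemma convex_on_edom:
  assumes conv: "econvex h" and nonneg: "\<And>v. 0 \<le> h v"
  shows "convex_on (edom h) (\<lambda>v. real_of_ereal (h v))"
proof -
  have eq: "h v = ereal (real_of_ereal (h v))" if "v \<in> edom h" for v
    using that nonneg[of v] by (cases "h v") (auto simp: edom_def)
  have main: "h (s *\<^sub>R v + t *\<^sub>R w) \<le> ereal (s * real_of_ereal (h v) + t * real_of_ereal (h w))"
    if "v \<in> edom h" "w \<in> edom h" "0 \<le> s" "0 \<le> t" "s + t = 1" for v w s t
  proof -
    have s: "s = 1 - t" using that by simp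
    have "h ((1 - t) *\<^sub>R v + t *\<^sub>R w) \<le> ereal (1 - t) * h v + ereal t * h w"
      using conv that unfolding econvex_def by simp
    also have "\<dots> = ereal (1 - t) * ereal (real_of_ereal (h v)) + ereal t * ereal (real_of_ereal (h w))"
      using eq that by metis
    finally show ?thesis by (simp add: s)
  qed
  have dom: "s *\<^sub>R v + t *\<^sub>R w \<in> edom h"
    if "v \<in> edom h" "w \<in> edom h" "0 \<le> s" "0 \<le> t" "s + t = 1" for v w s t
    using main[OF that] by (auto simp: edom_def intro: le_less_trans)
  show ?thesis
    unfolding convex_on_def convex_def
  proof (intro conjI ballI allI impI)
    fix v w and s t :: real
    assume "v \<in> edom h" "w \<in> edom h" "0 \<le> s" "0 \<le> t" "s + t = 1"
    note st = this
    show "s *\<^sub>R v + t *\<^sub>R w \<in> edom h" by (rule dom[OF st])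
    then show "real_of_ereal (h (s *\<^sub>R v + t *\<^sub>R w))
        \<le> s * real_of_ereal (h v) + t * real_of_ereal (h w)"
      using main[OF st] eq by (metis ereal_less_eq(3))
  qed
qed

text \<open>
  The iterates and their strong accumulation points lie in \<open>edom g\<close>, so that the estimates can be
  carried out with the real functions \<open>G\<close> and \<open>J\<close>, which agree with \<open>g\<close> and the objective there.
\<close>

locale prox_gradient =
  fixes f :: "'y::real_normed_vector dual \<Rightarrow> real"
    and g :: "'y dual \<Rightarrow> ereal"
    and grad :: "'y dual \<Rightarrow> 'y"
    and Lgrad La Lb :: real
    and u :: "nat \<Rightarrow> 'y dual"
    and L :: "nat \<Rightarrow> real"
  assumes g_nonneg: "\<And>v. 0 \<le> g v"
    and g_convex: "econvex g"
    and f_nonneg: "\<And>v. 0 \<le> f v"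
    and f_grad: "\<And>v. v \<in> edom g \<Longrightarrow> has_gateaux_derivative f (canonical_embedding (grad v)) v"
    and grad_lipschitz: "Lgrad-lipschitz_on (edom g) grad"
    and La_pos: "0 < La"
    and iterates: "prox_grad_iterates f grad g La Lb u L"
begin

definition G :: "'y dual \<Rightarrow> real" where
  "G v = real_of_ereal (g v)"

definition J :: "'y dual \<Rightarrow> real" where
  "J v = f v + G v"

text \<open>The convex part of the subproblem: \<open>\<Q>\<close> without its quadratic term.\<close>

definition model :: "nat \<Rightarrow> 'y dual \<Rightarrow> real" where
  "model k v = f (u k) + blinfun_apply (v - u k) (grad (u k)) + G v"

definition len :: "nat \<Rightarrow> real" where
  "len k = norm (u (Suc k) - u k)"

lemma g_eq: "v \<in> edom g \<Longrightarrow> g v = ereal (G v)"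
  using g_nonneg[of v] by (cases "g v") (auto simp: edom_def G_def)

lemma G_nonneg: "0 \<le> G v"
  using g_nonneg[of v] by (simp add: G_def real_of_ereal_pos)

lemma J_nonneg: "0 \<le> J v"
  using f_nonneg[of v] G_nonneg[of v] by (simp add: J_def)

lemma objective_eq: "v \<in> edom g \<Longrightarrow> objective f g v = ereal (J v)"
  by (simp add: objective_def g_eq J_def)

lemma convex_on_G: "convex_on (edom g) G"
  using convex_on_edom[OF g_convex g_nonneg] by (simp add: G_def[abs_def])

lemma convex_on_model: "convex_on (edom g) (model k)"
proof -
  let ?l = "\<lambda>v. f (u k) + blinfun_apply (v - u k) (grad (u k))"
  have "?l (s *\<^sub>R v + t *\<^sub>R w) = s * ?l v + t * ?l w" if "s + t = 1" for s t v w
  proof -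
    have s: "s = 1 - t" using that by simp
    show ?thesis by (simp add: s blinfun.bilinear_simps algebra_simps)
  qed
  then have "convex_on (edom g) ?l"
    using convex_on_G by (simp add: convex_on_def)
  from convex_on_add[OF this convex_on_G] show ?thesis
    by (simp add: model_def[abs_def])
qed

lemma model_centre: "model k (u k) = J (u k)"
  by (simp add: model_def J_def)

lemma prox_model_eq:
  "v \<in> edom g \<Longrightarrow> prox_model f grad g l v (u k) = ereal (model k v + l / 2 * (norm (v - u k))\<^sup>2)"
  by (simp add: prox_model_def model_def g_eq)

lemma L_bounds: "La \<le> L k" "L k \<le> Lb"
  using iterates by (auto simp: prox_grad_iterates_def)

lemma L_pos: "0 < L k"
  using L_bounds(1)[of k] La_pos by simp

lemma prox_model_minimal:
  "prox_model f grad g (L k) (u (Suc k)) (u k) \<le> prox_model f grad g (L k) v (u k)"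
  using iterates by (auto simp: prox_grad_iterates_def is_arg_min_def not_less)

lemma iterate_in_edom: "u k \<in> edom g"
proof (induction k)
  case 0
  then show ?case using iterates by (simp add: prox_grad_iterates_def)
next
  case (Suc k)
  have "prox_model f grad g (L k) (u (Suc k)) (u k) < \<infinity>"
    using le_less_trans[OF prox_model_minimal[of k "u k"], of \<infinity>] prox_model_eq[OF Suc, of "L k" k]
    by simp
  then show ?case
    by (cases "g (u (Suc k))") (auto simp: prox_model_def edom_def)
qed

lemma step_minimal:
  assumes "v \<in> edom g"
  shows "model k (u (Suc k)) + L k / 2 * (len k)\<^sup>2 \<le> model k v + L k / 2 * (norm (v - u k))\<^sup>2"
  using prox_model_minimal[of k v] prox_model_eq[OF assms] prox_model_eq[OF iterate_in_edom]
  by (simp add: len_def)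

lemma step_upper_model: "J (u (Suc k)) \<le> model k (u (Suc k)) + L k / 2 * (len k)\<^sup>2"
  using iterates prox_model_eq[OF iterate_in_edom] objective_eq[OF iterate_in_edom]
  by (simp add: prox_grad_iterates_def len_def)

text \<open>
  Since \<open>u k\<close> is the centre of the quadratic term, the minimizer gains \<open>L k * (len k)\<^sup>2\<close> in the
  model; the sufficient-decrease test gives back at most half of this.
\<close>

lemma descent: "La / 2 * (len k)\<^sup>2 \<le> J (u k) - J (u (Suc k))"
proof -
  have "model k (u (Suc k)) + L k * (len k)\<^sup>2 \<le> model k (u k)"
    using prox_minimizer_decrease[OF convex_on_model iterate_in_edom iterate_in_edom]
      step_minimal[of _ k] L_pos[of k]
    by (simp add: len_def)
  then have "J (u (Suc k)) + L k / 2 * (len k)\<^sup>2 \<le> J (u k)"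
    using step_upper_model[of k] by (simp add: model_centre)
  moreover have "La / 2 * (len k)\<^sup>2 \<le> L k / 2 * (len k)\<^sup>2"
    using L_bounds(1)[of k] by (intro mult_right_mono) auto
  ultimately show ?thesis by simp
qed

lemma J_decreasing: "J (u (Suc k)) \<le> J (u k)"
proof -
  have "0 \<le> La / 2 * (len k)\<^sup>2" using La_pos by simp
  with descent[of k] show ?thesis by simp
qed

text \<open>
  This is the optimality condition of the subproblem. The norm of \<open>U\<close> need not be
  differentiable, so only the size of the residual \<open>\<nabla>f(u\<^sub>k) + \<xi>\<close> is controlled: the model lies
  above a cone of slope \<open>L k * len k\<close>, and a subgradient of the model whose norm is at most
  this slope, minus \<open>\<nabla>f(u\<^sub>k)\<close>, is the required \<open>\<xi>\<close>.
\<close>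

lemma optimal_subgradient:
  obtains \<xi> where "\<xi> \<in> subdifferential g (u (Suc k))"
    and "norm (canonical_embedding (grad (u k)) + \<xi>) \<le> L k * len k"
proof -
  have "model k (u (Suc k)) - L k * len k * norm (v - u (Suc k)) \<le> model k v"
    if "v \<in> edom g" for v
    using prox_minimizer_above_cone[OF convex_on_model iterate_in_edom that]
      step_minimal[of _ k] L_pos[of k]
    by (simp add: len_def)
  moreover have "0 \<le> L k * len k" using L_pos[of k] by (simp add: len_def)
  ultimately obtain l :: "'y dual dual" where l: "norm l \<le> L k * len k"
    "\<And>v. v \<in> edom g \<Longrightarrow> model k (u (Suc k)) + l (v - u (Suc k)) \<le> model k v"
    using convex_subgradient_above_cone[OF convex_on_model iterate_in_edom[of "Suc k"], of "L k * len k" k]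
    by blast
  let ?\<xi> = "l - canonical_embedding (grad (u k))"
  have "g (u (Suc k)) + ereal (?\<xi> (v - u (Suc k))) \<le> g v" for v
  proof (cases "v \<in> edom g")
    case True
    then show ?thesis
      using l(2)[OF True] g_eq[OF True] g_eq[OF iterate_in_edom[of "Suc k"]]
      by (simp add: model_def blinfun.bilinear_simps)
  next
    case False
    then show ?thesis by (simp add: edom_def)
  qed
  then have "?\<xi> \<in> subdifferential g (u (Suc k))"
    using g_eq[OF iterate_in_edom[of "Suc k"]] by (simp add: subdifferential_def)
  with l(1) that[of ?\<xi>] show ?thesis by simp
qed

lemma grad_step: "norm (grad (u (Suc k)) - grad (u k)) \<le> Lgrad * len k"
  using lipschitz_on_normD[OF grad_lipschitz iterate_in_edom iterate_in_edom] by (simp add: len_def)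

text \<open>
  The residual at the new iterate splits into the change of the gradient over the step and the
  residual of the optimality condition; both are proportional to the length of the step. For the
  predual, the norm of \<open>Y\<close> is read off in the bidual, where the optimality condition lives.
\<close>

lemma inf_sq_residual_le:
  assumes predual: "X = Predual \<Longrightarrow>
      \<exists>y. canonical_embedding y \<in> subdifferential g (u (Suc k)) \<and>
        - canonical_embedding (grad (u k)) - canonical_embedding y \<in>
          (*\<^sub>R) (L k / 2) ` subdifferential (\<lambda>v. ereal ((norm (v - u k))\<^sup>2)) (u (Suc k))"
  shows "inf_sq_residual X grad g (u (Suc k)) \<le> ereal (((Lgrad + Lb) * len k)\<^sup>2)"
proof -
  have Lb: "L k * len k \<le> Lb * len k"
    using L_bounds(2)[of k] by (intro mult_right_mono) (auto simp: len_def)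
  show ?thesis
  proof (cases X)
    case Bidual
    obtain \<xi> where \<xi>: "\<xi> \<in> subdifferential g (u (Suc k))"
      "norm (canonical_embedding (grad (u k)) + \<xi>) \<le> L k * len k"
      by (rule optimal_subgradient)
    have "canonical_embedding (grad (u (Suc k))) + \<xi>
        = canonical_embedding (grad (u (Suc k)) - grad (u k)) + (canonical_embedding (grad (u k)) + \<xi>)"
      by (simp add: canonical_embedding_diff)
    then have "norm (canonical_embedding (grad (u (Suc k))) + \<xi>)
        \<le> norm (grad (u (Suc k)) - grad (u k)) + norm (canonical_embedding (grad (u k)) + \<xi>)"
      by (metis norm_triangle_ineq norm_canonical_embedding)
    also have "\<dots> \<le> (Lgrad + Lb) * len k"
      using grad_step[of k] \<xi>(2) Lb by (simp add: distrib_right)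
    finally have "(norm (canonical_embedding (grad (u (Suc k))) + \<xi>))\<^sup>2 \<le> ((Lgrad + Lb) * len k)\<^sup>2"
      by (intro power_mono) auto
    then show ?thesis using \<xi>(1) by (auto simp: Bidual intro: INF_lower2)
  next
    case Predual
    then obtain y \<zeta> where y: "canonical_embedding y \<in> subdifferential g (u (Suc k))"
      and \<zeta>: "\<zeta> \<in> subdifferential (\<lambda>v. ereal ((norm (v - u k))\<^sup>2)) (u (Suc k))"
      and eq: "- canonical_embedding (grad (u k)) - canonical_embedding y = (L k / 2) *\<^sub>R \<zeta>"
      using predual by blast
    have "norm (grad (u k) + y) = norm (- canonical_embedding (grad (u k)) - canonical_embedding y)"
      by (metis canonical_embedding_add minus_add_distrib norm_canonical_embedding norm_minus_cancel
          diff_conv_add_uminus)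
    also have "\<dots> = L k / 2 * norm \<zeta>" using L_pos[of k] by (simp add: eq)
    also have "\<dots> \<le> L k / 2 * (2 * len k)"
      using norm_subgradient_sq_dist_le[OF \<zeta>] L_pos[of k]
      by (intro mult_left_mono) (auto simp: len_def)
    finally have opt: "norm (grad (u k) + y) \<le> L k * len k" by simp
    have "norm (grad (u (Suc k)) + y) \<le> norm (grad (u (Suc k)) - grad (u k)) + norm (grad (u k) + y)"
      using norm_triangle_ineq[of "grad (u (Suc k)) - grad (u k)" "grad (u k) + y"] by simp
    also have "\<dots> \<le> (Lgrad + Lb) * len k"
      using grad_step[of k] opt Lb by (simp add: distrib_right)
    finally have "(norm (grad (u (Suc k)) + y))\<^sup>2 \<le> ((Lgrad + Lb) * len k)\<^sup>2"
      by (intro power_mono) auto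
    then show ?thesis using y by (auto simp: Predual intro: INF_lower2)
  qed
qed

text \<open>
  The residual bounds the new gap by a multiple of \<open>(len k)\<^sup>2\<close>, and the descent bounds
  \<open>(len k)\<^sup>2\<close> by the difference of the two gaps; solving for the new gap gives the factor.
\<close>

lemma PLK_contraction:
  assumes PLK: "PLK_property X f grad g ubar R lam eta" and lam: "0 < lam"
    and ubar: "ubar \<in> edom g"
    and near: "norm (u (Suc k) - ubar) \<le> R" "J (u (Suc k)) \<le> J ubar + eta"
    and residual: "inf_sq_residual X grad g (u (Suc k)) \<le> ereal (((Lgrad + Lb) * len k)\<^sup>2)"
  shows "J (u (Suc k)) - J ubar \<le> 1 / (1 + La / (lam * (Lgrad + Lb)\<^sup>2)) * (J (u k) - J ubar)"
proof -
  let ?S = "lam * (Lgrad + Lb)\<^sup>2"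
  have "0 \<le> Lgrad" using grad_lipschitz by (rule lipschitz_on_nonneg)
  then have S: "0 < ?S" using La_pos L_bounds[of k] lam by simp
  have cancel: "La / s * (s / La * x) = x" if "s \<noteq> 0" for s x
    using that La_pos by simp
  have "ereal (J (u (Suc k)) - J ubar) \<le> ereal (lam / 2) * inf_sq_residual X grad g (u (Suc k))"
    using PLK near unfolding PLK_property_def
    by (auto simp: objective_eq[OF ubar] objective_eq[OF iterate_in_edom[of "Suc k"]]
        dest!: spec[of _ "u (Suc k)"])
  also have "\<dots> \<le> ereal (lam / 2) * ereal (((Lgrad + Lb) * len k)\<^sup>2)"
    using lam residual by (intro ereal_mult_left_mono) auto
  finally have "J (u (Suc k)) - J ubar \<le> lam / 2 * ((Lgrad + Lb) * len k)\<^sup>2" by simp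
  also have "\<dots> = ?S / La * (La / 2 * (len k)\<^sup>2)"
    using La_pos by (simp add: power_mult_distrib)
  also have "\<dots> \<le> ?S / La * (J (u k) - J (u (Suc k)))"
    using descent[of k] S La_pos by (intro mult_left_mono) auto
  finally have "La / ?S * (J (u (Suc k)) - J ubar) \<le> La / ?S * (?S / La * (J (u k) - J (u (Suc k))))"
    using S La_pos by (intro mult_left_mono) auto
  also have "\<dots> = J (u k) - J (u (Suc k))"
    using S by (intro cancel) linarith
  finally have "(1 + La / ?S) * (J (u (Suc k)) - J ubar) \<le> J (u k) - J ubar"
    by (simp add: distrib_right)
  moreover have "0 < 1 + La / ?S" using S La_pos by (simp add: add_pos_pos)
  ultimately show ?thesis by (simp add: pos_le_divide_eq mult.commute)
qed

section \<open>Convergence of the objective values\<close>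

text \<open>
  The mean value theorem along the segment, which stays in the convex set \<open>edom g\<close>. It gives
  norm continuity of \<open>f\<close> on \<open>edom g\<close>, hence convergence of \<open>f\<close> along the subsequence.
\<close>

lemma f_growth:
  assumes "v \<in> edom g" "w \<in> edom g"
  shows "\<bar>f v - f w\<bar> \<le> (norm (grad w) + Lgrad * norm (v - w)) * norm (v - w)"
proof -
  let ?p = "\<lambda>t. w + t *\<^sub>R (v - w)"
  have dom: "?p t \<in> edom g" if "0 \<le> t" "t \<le> 1" for t
  proof -
    have "?p t = (1 - t) *\<^sub>R w + t *\<^sub>R v" by (simp add: algebra_simps)
    then show ?thesis using convex_on_combination(1)[OF convex_on_G assms(2,1)] that by simp
  qed
  have deriv: "((\<lambda>t. f (?p t)) has_real_derivative (v - w) (grad (?p t))) (at t)"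
    if "0 \<le> t" "t \<le> 1" for t
  proof -
    have shift: "?p (t + h) = ?p t + h *\<^sub>R (v - w)" for h by (simp add: scaleR_add_left)
    show ?thesis
      unfolding DERIV_def shift
      using f_grad[OF dom[OF that]] by (simp add: has_gateaux_derivative_def)
  qed
  obtain t where t: "0 < t" "t < 1" "f (?p 1) - f (?p 0) = (1 - 0) * (v - w) (grad (?p t))"
    using MVT2[of 0 1 "\<lambda>t. f (?p t)" "\<lambda>t. (v - w) (grad (?p t))"] deriv by auto
  have "norm (grad (?p t)) \<le> norm (grad w) + norm (grad (?p t) - grad w)"
    using norm_triangle_ineq[of "grad w" "grad (?p t) - grad w"] by simp
  also have "norm (grad (?p t) - grad w) \<le> Lgrad * norm (?p t - w)"
    using t by (intro lipschitz_on_normD[OF grad_lipschitz] dom assms) auto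
  also have "\<dots> \<le> Lgrad * norm (v - w)"
    using t lipschitz_on_nonneg[OF grad_lipschitz]
    by (intro mult_left_mono) (auto simp: mult_left_le_one_le)
  finally have "norm (grad (?p t)) \<le> norm (grad w) + Lgrad * norm (v - w)" by simp
  then have "norm (v - w) * norm (grad (?p t)) \<le> norm (v - w) * (norm (grad w) + Lgrad * norm (v - w))"
    by (intro mult_left_mono) auto
  moreover have "\<bar>(v - w) (grad (?p t))\<bar> \<le> norm (v - w) * norm (grad (?p t))"
    using norm_blinfun[of "v - w" "grad (?p t)"] by simp
  ultimately show ?thesis using t(3) by (simp add: mult.commute)
qed

context
  fixes r :: "nat \<Rightarrow> nat" and ubar :: "'y dual"
  assumes g_lsc: "seq_weak_star_lsc_on UNIV g"
    and r: "strict_mono r" and sub: "(\<lambda>j. u (r j)) \<longlonglongrightarrow> ubar"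
begin

lemma g_le_liminf: "g ubar \<le> liminf (\<lambda>j. g (u (r j)))"
proof -
  have "seq_weak_star_tendsto (\<lambda>j. u (r j)) ubar"
    unfolding seq_weak_star_tendsto_def using sub by (auto intro: blinfun.tendsto)
  then show ?thesis using g_lsc by (auto simp: seq_weak_star_lsc_on_def)
qed

lemma limit_in_edom: "ubar \<in> edom g"
proof -
  have "g (u (r j)) \<le> ereal (J (u 0))" for j
  proof -
    have "G (u (r j)) \<le> J (u (r j))" using f_nonneg by (simp add: J_def)
    also have "\<dots> \<le> J (u 0)"
      using lift_Suc_antimono_le[of "\<lambda>k. J (u k)", OF J_decreasing, of 0 "r j"] by simp
    finally show ?thesis by (simp add: g_eq[OF iterate_in_edom])
  qed
  \<comment> \<open>The domain need not be closed, but the values stay below \<open>J (u 0)\<close>, and sublevel sets of \<open>g\<close> are closed.\<close>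
  then have "Limsup sequentially (\<lambda>j. g (u (r j))) \<le> ereal (J (u 0))"
    by (intro Limsup_bounded) auto
  with g_le_liminf Liminf_le_Limsup[of sequentially "\<lambda>j. g (u (r j))"]
  have "g ubar \<le> ereal (J (u 0))" by (auto intro: order_trans)
  then show ?thesis by (auto simp: edom_def intro: le_less_trans)
qed

lemma f_tendsto: "(\<lambda>j. f (u (r j))) \<longlonglongrightarrow> f ubar"
proof -
  let ?d = "\<lambda>j. norm (u (r j) - ubar)"
  have "?d \<longlonglongrightarrow> 0" using sub by (simp add: LIM_zero tendsto_norm_zero)
  from tendsto_mult[OF tendsto_add[OF tendsto_const[of "norm (grad ubar)"]
        tendsto_mult_left[OF this, of Lgrad]] this]
  have "(\<lambda>j. (norm (grad ubar) + Lgrad * ?d j) * ?d j) \<longlonglongrightarrow> 0" by simp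
  then have "(\<lambda>j. f (u (r j)) - f ubar) \<longlonglongrightarrow> 0"
    by (rule Lim_null_comparison[rotated])
      (use f_growth[OF iterate_in_edom limit_in_edom] in \<open>auto intro!: always_eventually\<close>)
  then show ?thesis by (rule LIM_zero_cancel)
qed

text \<open>
  The values decrease to some \<open>j\<close>. Lower semicontinuity of \<open>g\<close> together with convergence of
  \<open>f\<close> along the subsequence gives \<open>J ubar \<le> j\<close>. Conversely, the limit point competes in the
  subproblem at \<open>u (r i)\<close>, whose model value at \<open>ubar\<close> tends to \<open>J ubar\<close>, so \<open>j \<le> J ubar\<close>.
\<close>

lemma J_tendsto: "(\<lambda>k. J (u k)) \<longlonglongrightarrow> J ubar"
proof -
  have "decseq (\<lambda>k. J (u k))" using J_decreasing by (intro decseq_SucI)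
  then obtain j where j: "(\<lambda>k. J (u k)) \<longlonglongrightarrow> j"
    using decseq_convergent[of "\<lambda>k. J (u k)" 0] J_nonneg by blast
  have r_top: "filterlim r at_top sequentially" using r by (rule filterlim_subseq)
  have jr: "(\<lambda>i. J (u (r i))) \<longlonglongrightarrow> j" and jSr: "(\<lambda>i. J (u (Suc (r i)))) \<longlonglongrightarrow> j"
    using filterlim_compose[OF j r_top] filterlim_compose[OF LIMSEQ_Suc[OF j] r_top] by auto
  have "(\<lambda>i. J (u (r i)) - f (u (r i))) \<longlonglongrightarrow> j - f ubar"
    by (intro tendsto_diff jr f_tendsto)
  then have "(\<lambda>i. g (u (r i))) \<longlonglongrightarrow> ereal (j - f ubar)"
    by (simp add: J_def g_eq[OF iterate_in_edom])
  then have "liminf (\<lambda>i. g (u (r i))) = ereal (j - f ubar)"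
    by (intro lim_imp_Liminf) auto
  with g_le_liminf have lower: "J ubar \<le> j"
    by (simp add: J_def g_eq[OF limit_in_edom])
  let ?d = "\<lambda>i. norm (ubar - u (r i))"
  let ?B = "\<lambda>i. f (u (r i)) + ?d i * (norm (grad ubar) + Lgrad * ?d i) + G ubar + Lb / 2 * (?d i)\<^sup>2"
  have "J (u (Suc (r i))) \<le> ?B i" for i
  proof -
    have "J (u (Suc (r i))) \<le> model (r i) ubar + L (r i) / 2 * (?d i)\<^sup>2"
      using step_upper_model[of "r i"] step_minimal[OF limit_in_edom, of "r i"] by linarith
    moreover have "L (r i) / 2 * (?d i)\<^sup>2 \<le> Lb / 2 * (?d i)\<^sup>2"
      using L_bounds(2)[of "r i"] by (intro mult_right_mono) auto
    moreover have "(ubar - u (r i)) (grad (u (r i))) \<le> ?d i * (norm (grad ubar) + Lgrad * ?d i)"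
    proof -
      have "norm (grad (u (r i))) \<le> norm (grad ubar) + norm (grad ubar - grad (u (r i)))"
        using norm_triangle_ineq3[of "grad ubar" "grad (u (r i))"] by simp
      also have "\<dots> \<le> norm (grad ubar) + Lgrad * ?d i"
        using lipschitz_on_normD[OF grad_lipschitz limit_in_edom iterate_in_edom] by simp
      finally have "?d i * norm (grad (u (r i))) \<le> ?d i * (norm (grad ubar) + Lgrad * ?d i)"
        by (intro mult_left_mono) auto
      then show ?thesis
        using norm_blinfun[of "ubar - u (r i)" "grad (u (r i))"] by simp
    qed
    ultimately show ?thesis by (simp add: model_def)
  qed
  moreover have "?B \<longlonglongrightarrow> J ubar"
  proof -
    have d: "?d \<longlonglongrightarrow> 0"
      using sub by (simp add: norm_minus_commute[of ubar] LIM_zero tendsto_norm_zero)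
    have "?B \<longlonglongrightarrow> f ubar + 0 * (norm (grad ubar) + Lgrad * 0) + G ubar + Lb / 2 * 0\<^sup>2"
      by (intro tendsto_add tendsto_mult tendsto_power tendsto_const f_tendsto d)
    then show ?thesis by (simp add: J_def)
  qed
  ultimately have "j \<le> J ubar"
    using jSr by (intro tendsto_le[of sequentially ?B _ "\<lambda>i. J (u (Suc (r i)))"]) auto
  with lower j show ?thesis by simp
qed

end

end

section \<open>Linear convergence\<close>

theorem theorem5p5:
  fixes f :: "'y::banach dual \<Rightarrow> real"
    and g :: "'y dual \<Rightarrow> ereal"
    and grad :: "'y dual \<Rightarrow> 'y"
    and Lgrad La Lb R lam eta :: real
    and u :: "nat \<Rightarrow> 'y dual"
    and L :: "nat \<Rightarrow> real"
    and r :: "nat \<Rightarrow> nat"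
    and ubar :: "'y dual"
    and X :: residual_space
  assumes separable: "separable_space (euclidean :: 'y topology)"
    and g_nonneg: "\<forall>v. 0 \<le> g v"
    and g_proper: "proper_fun g"
    and g_convex: "econvex g"
    and g_lsc: "seq_weak_star_lsc_on UNIV g"
    and f_nonneg: "\<forall>v. 0 \<le> f v"
    and f_lsc: "seq_weak_star_lsc_on (edom g) (\<lambda>v. ereal (f v))"
    and f_gateaux: "\<exists>N. open N \<and> edom g \<subseteq> N \<and> (\<forall>v\<in>N. \<exists>D. has_gateaux_derivative f D v)"
    and f_grad: "\<forall>v\<in>edom g. has_gateaux_derivative f (canonical_embedding (grad v)) v"
    and grad_lipschitz: "Lgrad-lipschitz_on (edom g) grad"
    and coercive: "\<forall>w :: nat \<Rightarrow> 'y dual.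
           filterlim (\<lambda>k. norm (w k)) at_top sequentially \<longrightarrow>
           (\<lambda>k. objective f g (w k)) \<longlonglongrightarrow> \<infinity>"
    and stepsizes: "0 < La" "La \<le> Lb"
    and iterates: "prox_grad_iterates f grad g La Lb u L"
    and subseq: "strict_mono r" "(\<lambda>j. u (r j)) \<longlonglongrightarrow> ubar"
    and constants: "R > 0" "lam > 0" "eta > 0"
    and PLK: "PLK_property X f grad g ubar R lam eta"
    and subgradients_in_predual: "X = Predual \<longrightarrow>
           (\<forall>k. \<exists>y. canonical_embedding y \<in> subdifferential g (u (Suc k)) \<and>
              - canonical_embedding (grad (u k)) - canonical_embedding y \<in>
                (*\<^sub>R) (L k / 2) `
                  subdifferential (\<lambda>v. ereal ((norm (v - u k))\<^sup>2)) (u (Suc k)))"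
  shows "let \<sigma> = La / (lam * (Lgrad + Lb)\<^sup>2);
             \<mu> = sqrt (1 / (1 + \<sigma>))
         in \<mu> < 1 \<and>
            (\<exists>C>0. \<forall>\<^sub>F k in sequentially.
               objective f g (u (Suc k)) - objective f g ubar
                 \<le> ereal (1 / (1 + \<sigma>)) * (objective f g (u k) - objective f g ubar) \<and>
               norm (u k - ubar) \<le> C * \<mu> ^ k)"
proof -
  interpret prox_gradient f g grad Lgrad La Lb u L
    using g_nonneg g_convex f_nonneg f_grad grad_lipschitz stepsizes(1) iterates
    by unfold_locales auto
  define \<sigma> where "\<sigma> = La / (lam * (Lgrad + Lb)\<^sup>2)"
  define q where "q = 1 / (1 + \<sigma>)"
  define \<mu> where "\<mu> = sqrt q"
  define e where "e k = J (u k) - J ubar" for k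
  \<comment> \<open>The scaling makes \<open>(1 - \<mu>) * \<psi> k\<close> the bound on the step that the descent gives, and the
    square root turns the contraction of \<open>e\<close> by \<open>\<mu>\<^sup>2\<close> into one by \<open>\<mu>\<close>.\<close>
  define \<psi> where "\<psi> k = sqrt (2 / La) * sqrt (e k) / (1 - \<mu>)" for k
  have "0 < lam * (Lgrad + Lb)\<^sup>2"
    using constants stepsizes lipschitz_on_nonneg[OF grad_lipschitz] by simp
  then have "0 < \<sigma>" using stepsizes by (simp add: \<sigma>_def)
  then have q: "0 < q" "q < 1" by (auto simp: q_def)
  then have \<mu>: "0 < \<mu>" "\<mu> < 1" by (auto simp: \<mu>_def)
  have ubar: "ubar \<in> edom g" using g_lsc subseq by (rule limit_in_edom)
  have J_lim: "(\<lambda>k. J (u k)) \<longlonglongrightarrow> J ubar" using g_lsc subseq by (rule J_tendsto)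
  have "decseq (\<lambda>k. J (u k))" using J_decreasing by (intro decseq_SucI)
  from decseq_ge[OF this J_lim] have e_nonneg: "0 \<le> e k" for k by (simp add: e_def)
  have e_lim: "e \<longlonglongrightarrow> 0"
    unfolding e_def using J_lim by (rule LIM_zero)
  have "\<forall>\<^sub>F k in sequentially. e (Suc k) < eta"
    using LIMSEQ_Suc[OF e_lim] constants(3) by (rule order_tendstoD(2))
  then have contraction: "\<forall>\<^sub>F k in sequentially. norm (u (Suc k) - ubar) \<le> R \<longrightarrow> e (Suc k) \<le> q * e k"
  proof eventually_elim
    case (elim k)
    have "inf_sq_residual X grad g (u (Suc k)) \<le> ereal (((Lgrad + Lb) * len k)\<^sup>2)"
      using subgradients_in_predual by (intro inf_sq_residual_le) blast
    then show ?case
      using PLK_contraction[OF PLK constants(2) ubar, of k] elim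
      by (simp add: e_def q_def \<sigma>_def)
  qed
  have "\<exists>C>0. \<forall>\<^sub>F k in sequentially. dist (u k) ubar \<le> R \<and> dist (u k) ubar \<le> C * \<mu> ^ k"
  proof (rule trapped_sequence_converges_linearly[OF \<mu> constants(1) _ _ _ _ subseq])
    show "0 \<le> \<psi> k" for k
      using stepsizes e_nonneg[of k] \<mu> by (simp add: \<psi>_def)
    have "\<psi> \<longlonglongrightarrow> sqrt (2 / La) * sqrt 0 / (1 - \<mu>)"
      unfolding \<psi>_def using \<mu> by (intro tendsto_intros e_lim) auto
    then show "\<psi> \<longlonglongrightarrow> 0" by simp
    show "dist (u (Suc k)) (u k) \<le> (1 - \<mu>) * \<psi> k" for k
    proof -
      have "La / 2 * (len k)\<^sup>2 \<le> e k"
        using descent[of k] e_nonneg[of "Suc k"] by (simp add: e_def)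
      then have "(len k)\<^sup>2 \<le> 2 / La * e k" using stepsizes by (simp add: field_simps)
      then have "len k \<le> sqrt (2 / La * e k)" by (rule real_le_rsqrt)
      then have "len k \<le> sqrt (2 / La) * sqrt (e k)" by (simp only: real_sqrt_mult)
      moreover have "(1 - \<mu>) * \<psi> k = sqrt (2 / La) * sqrt (e k)" using \<mu> by (simp add: \<psi>_def)
      ultimately show ?thesis by (simp add: len_def dist_norm)
    qed
    show "\<forall>\<^sub>F k in sequentially. dist (u (Suc k)) ubar \<le> R \<longrightarrow> \<psi> (Suc k) \<le> \<mu> * \<psi> k"
      using contraction
    proof eventually_elim
      case (elim k)
      have "\<psi> (Suc k) \<le> \<mu> * \<psi> k" if "e (Suc k) \<le> q * e k"
      proof -
        have "sqrt (e (Suc k)) \<le> \<mu> * sqrt (e k)"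
          using real_sqrt_le_mono[OF that] by (simp add: \<mu>_def real_sqrt_mult)
        then have "sqrt (2 / La) * sqrt (e (Suc k)) / (1 - \<mu>)
            \<le> sqrt (2 / La) * (\<mu> * sqrt (e k)) / (1 - \<mu>)"
          using \<mu> stepsizes by (intro divide_right_mono mult_left_mono) auto
        then show ?thesis by (simp add: \<psi>_def mult_ac)
      qed
      with elim show ?case by (simp add: dist_norm)
    qed
  qed
  then obtain C where C: "0 < C"
    "\<forall>\<^sub>F k in sequentially. dist (u k) ubar \<le> R \<and> dist (u k) ubar \<le> C * \<mu> ^ k"
    by blast
  have "\<forall>\<^sub>F k in sequentially. dist (u (Suc k)) ubar \<le> R"
    using C(2) by (subst eventually_sequentially_Suc) (auto elim: eventually_mono)
  with C(2) contraction have
    "\<forall>\<^sub>F k in sequentially.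
      objective f g (u (Suc k)) - objective f g ubar
        \<le> ereal q * (objective f g (u k) - objective f g ubar) \<and>
      norm (u k - ubar) \<le> C * \<mu> ^ k"
  proof eventually_elim
    case (elim k)
    then show ?case
      by (simp add: objective_eq[OF ubar] objective_eq[OF iterate_in_edom] e_def dist_norm)
  qed
  with C(1) \<mu> show ?thesis
    unfolding Let_def \<sigma>_def[symmetric] q_def[symmetric] \<mu>_def[symmetric] by blast
qed

end
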